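(* Let $A=(A_1\;\;A_2)\in\mathbb{R}^{m\times n}$ with $A_1\in\mathbb{R}^{m\times k}$ and $A_2\in\mathbb{R}^{m\times(n-k)}$, and let $\tau>0$. For a weight matrix $W=(W_1\;\;W_2)$ with $W_1\in\mathbb{R}^{m\times k}$, $W_2\in\mathbb{R}^{m\times(n-k)}$, let $(\hat X_1(W)\;\;\hat X_2(W))$ be a solution of $$\min_{X_1\in\mathbb{R}^{m\times k},\,X_2\in\mathbb{R}^{m\times(n-k)}}\Big\{\big\|\big((A_1\;\;A_2)-(X_1\;\;X_2)\big)\odot(W_1\;\;W_2)\big\|_F^2+\tau\operatorname{rank}(X_1\;\;X_2)\Big\}.$$ For each integer $r$ let $\mathcal{A}_G^r$ be the set of all solutions of $$\min_{\substack{X_1,X_2\\ \operatorname{rank}(X_1\;\;X_2)\le r\\ X_1=A_1}}\|(A_1\;\;A_2)-(X_1\;\;X_2)\|_F^2 .$$ Then every accumulation point of $(\hat X_1(W)\;\;\hat X_2(W))$ as $(W_1)_{ij}\to\infty$ and $(W_2)_{ij}\to1$ belongs to $\bigcup_{0\le r\le\min\{m,n\}}\mathcal{A}_G^r$.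
   Context: $\|\cdot\|_F$ is the Frobenius norm and $\odot$ is the Hadamard (entrywise) product. The limit is taken with all entries of $W_1$ tending to $\infty$ and all entries of $W_2$ tending to $1$; an accumulation point is a limit of $(\hat X_1(W)\;\;\hat X_2(W))$ along some sequence of weights $W$ with this property. If the constraint set of the problem defining $\mathcal{A}_G^r$ is empty (i.e. $r<\operatorname{rank}(A_1)$), then $\mathcal{A}_G^r=\emptyset$. *)

theory Defs
  imports "HOL-Analysis.Analysis" "Jordan_Normal_Form.DL_Rank"
begin

text \<open>Matrices are those of \<^theory>\<open>Jordan_Normal_Form.Matrix\<close>, so that the block sizes
  \<open>k\<close> and \<open>n - k\<close> are ordinary natural numbers; \<open>k = 0\<close> and \<open>k = n\<close> are allowed.\<close>

text \<open>The block matrix \<open>(A B)\<close>: the lower two blocks have no rows.\<close>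

definition hcat :: "real mat \<Rightarrow> real mat \<Rightarrow> real mat" where
  "hcat A B = four_block_mat A B (0\<^sub>m 0 (dim_col A)) (0\<^sub>m 0 (dim_col B))"

definition mat_rank :: "real mat \<Rightarrow> nat" where
  "mat_rank A = vec_space.rank (dim_row A) A"

definition hadamard :: "real mat \<Rightarrow> real mat \<Rightarrow> real mat" where
  "hadamard A B = mat (dim_row A) (dim_col A) (\<lambda>ij. A $$ ij * B $$ ij)"

definition frobenius_norm :: "real mat \<Rightarrow> real" where
  "frobenius_norm A = sqrt (\<Sum>i<dim_row A. \<Sum>j<dim_col A. (A $$ (i, j))\<^sup>2)"

definition block_pairs :: "nat \<Rightarrow> nat \<Rightarrow> nat \<Rightarrow> (real mat \<times> real mat) set" where
  "block_pairs m n k = carrier_mat m k \<times> carrier_mat m (n - k)"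

definition weighted_objective ::
  "real \<Rightarrow> real mat \<times> real mat \<Rightarrow> real mat \<times> real mat \<Rightarrow> real mat \<times> real mat \<Rightarrow> real" where
  "weighted_objective \<tau> = (\<lambda>(A1, A2) (W1, W2) (X1, X2).
     (frobenius_norm (hadamard (hcat A1 A2 - hcat X1 X2) (hcat W1 W2)))\<^sup>2
       + \<tau> * real (mat_rank (hcat X1 X2)))"

definition weighted_solution ::
  "nat \<Rightarrow> nat \<Rightarrow> nat \<Rightarrow> real \<Rightarrow> real mat \<times> real mat \<Rightarrow> real mat \<times> real mat
     \<Rightarrow> real mat \<times> real mat \<Rightarrow> bool" where
  "weighted_solution m n k \<tau> A W X \<longleftrightarrow>
     is_arg_min (weighted_objective \<tau> A W) (\<lambda>Y. Y \<in> block_pairs m n k) X"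

definition A_G ::
  "nat \<Rightarrow> nat \<Rightarrow> nat \<Rightarrow> real mat \<times> real mat \<Rightarrow> nat \<Rightarrow> (real mat \<times> real mat) set" where
  "A_G m n k = (\<lambda>(A1, A2) r.
     {X. is_arg_min (\<lambda>(X1, X2). (frobenius_norm (hcat A1 A2 - hcat X1 X2))\<^sup>2)
           (\<lambda>(X1, X2). (X1, X2) \<in> block_pairs m n k \<and> mat_rank (hcat X1 X2) \<le> r \<and> X1 = A1) X})"

text \<open>The weights \<open>W t = (W1 W2)\<close> satisfy \<open>(W1)\<^sub>i\<^sub>j \<longlonglongrightarrow> \<infinity>\<close> and
  \<open>(W2)\<^sub>i\<^sub>j \<longlonglongrightarrow> 1\<close> for every entry.\<close>

definition weights_limit ::
  "nat \<Rightarrow> nat \<Rightarrow> nat \<Rightarrow> (nat \<Rightarrow> real mat \<times> real mat) \<Rightarrow> bool" where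
  "weights_limit m n k W \<longleftrightarrow>
     (\<forall>t. W t \<in> block_pairs m n k) \<and>
     (\<forall>i<m. \<forall>j<k. filterlim (\<lambda>t. fst (W t) $$ (i, j)) at_top sequentially) \<and>
     (\<forall>i<m. \<forall>j<n - k. (\<lambda>t. snd (W t) $$ (i, j)) \<longlonglongrightarrow> 1)"

definition accumulation_point ::
  "nat \<Rightarrow> nat \<Rightarrow> nat \<Rightarrow> (real mat \<times> real mat \<Rightarrow> real mat \<times> real mat)
     \<Rightarrow> real mat \<times> real mat \<Rightarrow> bool" where
  "accumulation_point m n k Xhat X \<longleftrightarrow>
     X \<in> block_pairs m n k \<and>
     (\<exists>W. weights_limit m n k W \<and>
        (\<lambda>t. frobenius_norm (case_prod hcat (Xhat (W t)) - case_prod hcat X)) \<longlonglongrightarrow> 0)"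

end

theory Submission
  imports Defs
begin

text \<open>Comparing \<open>Xhat (W t)\<close> with the competitor \<open>(A1 0)\<close> bounds \<open>(A1 - X1) \<odot> W1\<close>, so the first block
  of the limit is \<open>A1\<close>. Let \<open>r\<close> be the rank of the limit. By lower semicontinuity the rank of
  \<open>Xhat (W t)\<close> is eventually at least \<open>r\<close>, so against any competitor \<open>(A1 Z)\<close> of rank at most \<open>r\<close>
  the rank penalties drop out, and the remaining inequality between the weighted errors of the
  second block passes to the limit.\<close>

section \<open>Rank expressed through Gram determinants of selected columns\<close>

lemma scalar_prod_self_eq_0_iff:
  fixes v :: "real vec"
  assumes "v \<in> carrier_vec n"
  shows "v \<bullet> v = 0 \<longleftrightarrow> v = 0\<^sub>v n"
  using conjugate_square_eq_0_vec[OF assms] by simp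

text \<open>Over the reals \<open>B\<close> and \<open>B\<^sup>T * B\<close> have the same kernel,
  because the quadratic form of \<open>B\<^sup>T * B\<close> at \<open>v\<close> is the squared
  length of \<open>B v\<close>. This turns independence of columns into the nonvanishing of a
  polynomial in the entries, a condition stable under limits. Distinctness is listed separately
  because independence of a set of columns does not see repetitions.\<close>

lemma gram_det_nonzero_iff:
  fixes B :: "real mat"
  assumes B: "B \<in> carrier_mat m r"
  shows "det (B\<^sup>T * B) \<noteq> 0 \<longleftrightarrow>
    distinct (cols B) \<and> module.lin_indpt class_ring (module_vec TYPE(real) m) (set (cols B))"
proof -
  interpret vec_space "TYPE(real)" m .
  have Bt: "B\<^sup>T \<in> carrier_mat r m" and G: "B\<^sup>T * B \<in> carrier_mat r r"
    using B by auto
  show ?thesis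
  proof
    assume nz: "det (B\<^sup>T * B) \<noteq> 0"
    have dist: "distinct (cols B)"
    proof (rule ccontr)
      assume "\<not> distinct (cols B)"
      then obtain a b where ab: "a \<noteq> b" "a < r" "b < r" "col B a = col B b"
        using B unfolding distinct_conv_nth by auto
      have "col (B\<^sup>T * B) a = col (B\<^sup>T * B) b"
        using ab by (simp add: col_mult2[OF Bt B])
      with det_identical_cols[OF G ab(1-3)] nz show False by simp
    qed
    moreover have "lin_indpt (set (cols B))"
    proof
      assume "lin_dep (set (cols B))"
      from lin_depE[OF B this dist] obtain v
        where v: "v \<in> carrier_vec r" "v \<noteq> 0\<^sub>v r" "B *\<^sub>v v = 0\<^sub>v m" by blast
      have "(B\<^sup>T * B) *\<^sub>v v = 0\<^sub>v r"
        using assoc_mult_mat_vec[OF Bt B v(1)] v(3) Bt by auto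
      with v nz det_0_iff_vec_prod_zero_field[OF G] show False by blast
    qed
    ultimately show "distinct (cols B) \<and> lin_indpt (set (cols B))" ..
  next
    assume ind: "distinct (cols B) \<and> lin_indpt (set (cols B))"
    show "det (B\<^sup>T * B) \<noteq> 0"
    proof
      assume "det (B\<^sup>T * B) = 0"
      then obtain v where v: "v \<in> carrier_vec r" "v \<noteq> 0\<^sub>v r" "(B\<^sup>T * B) *\<^sub>v v = 0\<^sub>v r"
        using det_0_iff_vec_prod_zero_field[OF G] by blast
      have Bv: "B *\<^sub>v v \<in> carrier_vec m" using B v by simp
      have "(B *\<^sub>v v) \<bullet> (B *\<^sub>v v) = (B\<^sup>T *\<^sub>v (B *\<^sub>v v)) \<bullet> v"
        using transpose_vec_mult_scalar[OF B v(1) Bv] by simp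
      also have "\<dots> = 0"
        using v assoc_mult_mat_vec[OF Bt B v(1)] by simp
      finally have "B *\<^sub>v v = 0\<^sub>v m" using scalar_prod_self_eq_0_iff[OF Bv] by simp
      with lin_depI[OF B v(1,2)] ind show False by blast
    qed
  qed
qed

text \<open>A maximal independent set of columns has as many elements as the rank; \<open>f\<close>
  records where these columns sit in \<open>X\<close>. Keeping positions rather than vectors allows
  the same selection to be applied to nearby matrices.\<close>

lemma mat_rank_witness:
  assumes X: "X \<in> carrier_mat m n"
  obtains f where "\<And>a. a < mat_rank X \<Longrightarrow> f a < n"
    and "det ((mat m (mat_rank X) (\<lambda>(i, a). X $$ (i, f a)))\<^sup>T
              * mat m (mat_rank X) (\<lambda>(i, a). X $$ (i, f a))) \<noteq> 0"
    and "mat_rank X \<le> m"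
proof -
  interpret vec_space "TYPE(real)" m .
  obtain S where S: "finite S" "maximal S (\<lambda>T. T \<subseteq> set (cols X) \<and> lin_indpt T)"
    using maximal_exists_superset[of "set (cols X)" "\<lambda>T. T \<subseteq> set (cols X) \<and> lin_indpt T" "{}"]
      lindep_span by (auto simp: lin_dep_def)
  then have sub: "S \<subseteq> set (cols X)" and ind: "lin_indpt S"
    unfolding maximal_def by auto
  have rk: "mat_rank X = card S"
    using rank_card_indpt[OF X S(2)] X by (simp add: mat_rank_def)
  have Sc: "S \<subseteq> carrier_vec m" using sub X cols_dim[of X] by auto
  have "card S \<le> m"
    using li_le_dim(2)[OF fin_dim _ ind] Sc by (simp add: dim_is_n)
  \<comment> \<open>An enumeration of \<open>S\<close> gives its vectors an order, so that they can
    serve as the columns of a matrix.\<close>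
  obtain xs where xs: "distinct xs" "set xs = S"
    using finite_distinct_list[OF S(1)] by blast
  have len: "length xs = card S" using xs distinct_card by metis
  have "\<exists>j. j < n \<and> xs ! a = col X j" if "a < card S" for a
  proof -
    have "xs ! a \<in> set (cols X)" using that xs sub len by (metis nth_mem subsetD)
    then show ?thesis using X by (auto simp: cols_def)
  qed
  then obtain f where f: "\<And>a. a < card S \<Longrightarrow> f a < n \<and> xs ! a = col X (f a)" by metis
  define B where "B = mat m (card S) (\<lambda>(i, a). X $$ (i, f a))"
  have B: "B \<in> carrier_mat m (card S)" by (simp add: B_def)
  have "cols B = xs"
  proof (rule nth_equalityI)
    fix a assume "a < length (cols B)"
    then have a: "a < card S" using B by simp
    then have "col B a = col X (f a)" using X f[OF a] by (auto simp: B_def intro!: eq_vecI)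
    then show "cols B ! a = xs ! a" using a B f by simp
  qed (use B len in simp)
  then have "det (B\<^sup>T * B) \<noteq> 0"
    using gram_det_nonzero_iff[OF B] xs ind by simp
  with f that[of f] \<open>card S \<le> m\<close> show ?thesis unfolding B_def rk by blast
qed

lemma mat_rank_le_min:
  assumes X: "X \<in> carrier_mat m n"
  shows "mat_rank X \<le> min m n"
proof -
  have "mat_rank X \<le> m" using mat_rank_witness[OF X] by metis
  moreover have "mat_rank X \<le> n"
    using vec_space.rank_le_nc[OF X] X by (simp add: mat_rank_def)
  ultimately show ?thesis by simp
qed

text \<open>By the Gram criterion the selected columns are \<open>r\<close> distinct independent
  columns of \<open>Y\<close>. In the application \<open>f\<close> is chosen for a limit matrix and
  \<open>Y\<close> is close to it.\<close>

lemma mat_rank_ge: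
  assumes Y: "Y \<in> carrier_mat m n" and f: "\<And>a. a < r \<Longrightarrow> f a < n"
    and nz: "det ((mat m r (\<lambda>(i, a). Y $$ (i, f a)))\<^sup>T * mat m r (\<lambda>(i, a). Y $$ (i, f a))) \<noteq> 0"
  shows "r \<le> mat_rank Y"
proof -
  interpret vec_space "TYPE(real)" m .
  define B where "B = mat m r (\<lambda>(i, a). Y $$ (i, f a))"
  have B: "B \<in> carrier_mat m r" by (simp add: B_def)
  have ind: "distinct (cols B)" "lin_indpt (set (cols B))"
    using nz gram_det_nonzero_iff[OF B] unfolding B_def by auto
  have "set (cols B) \<subseteq> set (cols Y)"
  proof
    fix v assume "v \<in> set (cols B)"
    then obtain a where a: "a < r" "v = col B a" using B by (auto simp: cols_def)
    then have "v = col Y (f a)" using Y f[OF a(1)] by (auto simp: B_def intro!: eq_vecI)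
    then show "v \<in> set (cols Y)" using Y f[OF a(1)] by (auto simp: cols_def)
  qed
  from rank_ge_card_indpt[OF Y this ind(2)] show ?thesis
    using distinct_card[OF ind(1)] B Y by (simp add: mat_rank_def)
qed

section \<open>Lower semicontinuity of the rank\<close>

lemma tendsto_det:
  fixes M :: "'b \<Rightarrow> real mat"
  assumes "\<And>t. M t \<in> carrier_mat r r" and "L \<in> carrier_mat r r"
    and lim: "\<And>i j. i < r \<Longrightarrow> j < r \<Longrightarrow> ((\<lambda>t. M t $$ (i, j)) \<longlongrightarrow> L $$ (i, j)) F"
  shows "((\<lambda>t. det (M t)) \<longlongrightarrow> det L) F"
  \<comment> \<open>The Leibniz formula is a polynomial in the entries; permutations keep the
    indices below \<open>r\<close>, where \<open>lim\<close> applies.\<close>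
  unfolding det_def'[OF assms(1)] det_def'[OF assms(2)]
  by (intro tendsto_sum tendsto_mult tendsto_const tendsto_prod lim)
    (auto dest: permutes_in_image)

text \<open>The columns witnessing the rank of \<open>X\<close> are held fixed. Their Gram
  determinant depends continuously on the matrix and is nonzero at \<open>X\<close>, hence
  eventually nonzero at \<open>Y t\<close>.\<close>

lemma eventually_mat_rank_ge:
  fixes Y :: "'b \<Rightarrow> real mat"
  assumes X: "X \<in> carrier_mat m n"
    and Y: "eventually (\<lambda>t. Y t \<in> carrier_mat m n) F"
    and lim: "\<And>i j. i < m \<Longrightarrow> j < n \<Longrightarrow> ((\<lambda>t. Y t $$ (i, j)) \<longlongrightarrow> X $$ (i, j)) F"
  shows "eventually (\<lambda>t. mat_rank X \<le> mat_rank (Y t)) F"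
proof -
  define r where "r = mat_rank X"
  obtain f where f: "\<And>a. a < r \<Longrightarrow> f a < n"
    and nz: "det ((mat m r (\<lambda>(i, a). X $$ (i, f a)))\<^sup>T * mat m r (\<lambda>(i, a). X $$ (i, f a))) \<noteq> 0"
    using mat_rank_witness[OF X] unfolding r_def by metis
  let ?G = "\<lambda>M :: real mat. (mat m r (\<lambda>(i, a). M $$ (i, f a)))\<^sup>T * mat m r (\<lambda>(i, a). M $$ (i, f a))"
  have ent: "?G M $$ (a, b) = (\<Sum>i = 0..<m. M $$ (i, f a) * M $$ (i, f b))"
    if "a < r" "b < r" for M a b
    using that by (simp add: scalar_prod_def)
  have "((\<lambda>t. det (?G (Y t))) \<longlongrightarrow> det (?G X)) F"
  proof (rule tendsto_det)
    fix a b assume ab: "a < r" "b < r"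
    show "((\<lambda>t. ?G (Y t) $$ (a, b)) \<longlongrightarrow> ?G X $$ (a, b)) F"
      unfolding ent[OF ab] using f ab by (intro tendsto_sum tendsto_mult lim) auto
  qed auto
  then have "eventually (\<lambda>t. det (?G (Y t)) \<noteq> 0) F"
    using nz tendsto_imp_eventually_ne by blast
  with Y show ?thesis
    unfolding r_def[symmetric] by eventually_elim (rule mat_rank_ge[OF _ f])
qed

section \<open>Block matrices, Frobenius errors and entrywise limits\<close>

lemma hcat_carrier:
  assumes "A \<in> carrier_mat m k" "B \<in> carrier_mat m l"
  shows "hcat A B \<in> carrier_mat m (k + l)"
  using assms unfolding hcat_def by auto

lemma hcat_index:
  assumes "A \<in> carrier_mat m k" "B \<in> carrier_mat m l" "i < m" "j < k + l"
  shows "hcat A B $$ (i, j) = (if j < k then A $$ (i, j) else B $$ (i, j - k))"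
  using assms unfolding hcat_def by auto

lemma frobenius_norm_sq:
  "(frobenius_norm A)\<^sup>2 = (\<Sum>i<dim_row A. \<Sum>j<dim_col A. (A $$ (i, j))\<^sup>2)"
  unfolding frobenius_norm_def by (intro real_sqrt_pow2 sum_nonneg) auto

text \<open>Stated for a function of two indices, to serve both the Frobenius norm and the weighted
  error of the first block.\<close>

lemma entry_sq_le_sum:
  fixes g :: "nat \<Rightarrow> nat \<Rightarrow> real"
  assumes "i < m" "j < n"
  shows "(g i j)\<^sup>2 \<le> (\<Sum>i<m. \<Sum>j<n. (g i j)\<^sup>2)"
proof -
  have "(g i j)\<^sup>2 \<le> (\<Sum>j<n. (g i j)\<^sup>2)"
    using assms by (intro member_le_sum) auto
  also have "\<dots> \<le> (\<Sum>i<m. \<Sum>j<n. (g i j)\<^sup>2)"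
    using assms by (intro member_le_sum[of i "{..<m}" "\<lambda>i. \<Sum>j<n. (g i j)\<^sup>2"] sum_nonneg) auto
  finally show ?thesis .
qed

lemma abs_entry_le_frobenius_norm:
  assumes "A \<in> carrier_mat m n" "i < m" "j < n"
  shows "\<bar>A $$ (i, j)\<bar> \<le> frobenius_norm A"
proof -
  have "(A $$ (i, j))\<^sup>2 \<le> (frobenius_norm A)\<^sup>2"
    unfolding frobenius_norm_sq using assms entry_sq_le_sum[of i m j n "\<lambda>i j. A $$ (i, j)"] by simp
  moreover have "0 \<le> frobenius_norm A"
    unfolding frobenius_norm_def by (auto intro!: sum_nonneg)
  ultimately show ?thesis by (simp add: abs_le_square_iff[symmetric])
qed

text \<open>Each entry of the difference is dominated by its norm. The dimensions of
  \<open>Y t\<close> are assumed only eventually, since minimizers are available only once all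
  weights are positive.\<close>

lemma frobenius_norm_tendsto_0_imp_entries:
  assumes X: "X \<in> carrier_mat m n"
    and Y: "eventually (\<lambda>t. Y t \<in> carrier_mat m n) F"
    and lim: "((\<lambda>t. frobenius_norm (Y t - X)) \<longlongrightarrow> 0) F"
    and ij: "i < m" "j < n"
  shows "((\<lambda>t. Y t $$ (i, j)) \<longlongrightarrow> X $$ (i, j)) F"
proof -
  have "eventually (\<lambda>t. norm (Y t $$ (i, j) - X $$ (i, j)) \<le> frobenius_norm (Y t - X)) F"
    using Y
  proof eventually_elim
    case (elim t)
    have "Y t - X \<in> carrier_mat m n" using X by (rule minus_carrier_mat)
    from abs_entry_le_frobenius_norm[OF this ij] show ?case using elim X ij by simp
  qed
  then have "((\<lambda>t. Y t $$ (i, j) - X $$ (i, j)) \<longlongrightarrow> 0) F"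
    by (rule Lim_null_comparison[OF _ lim])
  then show ?thesis using LIM_zero_iff by blast
qed

lemma sum_lessThan_add_split:
  fixes g :: "nat \<Rightarrow> 'a::comm_monoid_add"
  shows "(\<Sum>j<k + l. g j) = (\<Sum>j<k. g j) + (\<Sum>j<l. g (k + j))"
  by (induction l) (simp_all add: algebra_simps)

text \<open>Cutting the columns at \<open>k\<close> separates the block with diverging weights from
  the block whose weights tend to 1; the first sum vanishes when \<open>X1 = A1\<close>.\<close>

lemma weighted_error_split:
  assumes "A1 \<in> carrier_mat m k" "A2 \<in> carrier_mat m l" "X1 \<in> carrier_mat m k"
    "X2 \<in> carrier_mat m l" "W1 \<in> carrier_mat m k" "W2 \<in> carrier_mat m l"
  shows "(frobenius_norm (hadamard (hcat A1 A2 - hcat X1 X2) (hcat W1 W2)))\<^sup>2 =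
    (\<Sum>i<m. \<Sum>j<k. ((A1 $$ (i, j) - X1 $$ (i, j)) * W1 $$ (i, j))\<^sup>2) +
    (\<Sum>i<m. \<Sum>j<l. ((A2 $$ (i, j) - X2 $$ (i, j)) * W2 $$ (i, j))\<^sup>2)"
proof -
  note carr = hcat_carrier[OF assms(1,2)] hcat_carrier[OF assms(3,4)] hcat_carrier[OF assms(5,6)]
  note idx = hcat_index[OF assms(1,2)] hcat_index[OF assms(3,4)] hcat_index[OF assms(5,6)]
  show ?thesis
    using carr unfolding frobenius_norm_sq hadamard_def
    by (simp add: sum_lessThan_add_split idx sum.distrib)
qed

lemma error_split:
  assumes "A1 \<in> carrier_mat m k" "A2 \<in> carrier_mat m l" "X1 \<in> carrier_mat m k"
    "X2 \<in> carrier_mat m l"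
  shows "(frobenius_norm (hcat A1 A2 - hcat X1 X2))\<^sup>2 =
    (\<Sum>i<m. \<Sum>j<k. (A1 $$ (i, j) - X1 $$ (i, j))\<^sup>2) +
    (\<Sum>i<m. \<Sum>j<l. (A2 $$ (i, j) - X2 $$ (i, j))\<^sup>2)"
proof -
  note carr = hcat_carrier[OF assms(1,2)] hcat_carrier[OF assms(3,4)]
  note idx = hcat_index[OF assms(1,2)] hcat_index[OF assms(3,4)]
  show ?thesis
    using carr unfolding frobenius_norm_sq
    by (simp add: sum_lessThan_add_split idx sum.distrib)
qed

text \<open>Once \<open>w t\<close> is positive, the square of \<open>x t\<close> is at most
  \<open>C t\<close> divided by the square of \<open>w t\<close>. The bound may vary with
  \<open>t\<close> because the competitor's error involves the second-block weights.\<close>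

lemma tendsto_zero_of_mult_bounded:
  fixes x w :: "nat \<Rightarrow> real"
  assumes w: "filterlim w at_top sequentially"
    and C: "C \<longlonglongrightarrow> c" and le: "eventually (\<lambda>t. (x t * w t)\<^sup>2 \<le> C t) sequentially"
  shows "x \<longlonglongrightarrow> 0"
proof -
  have "(\<lambda>t. C t * (inverse (w t))\<^sup>2) \<longlonglongrightarrow> c * 0\<^sup>2"
    by (intro tendsto_intros C tendsto_inverse_0_at_top w)
  then have lim: "(\<lambda>t. C t * (inverse (w t))\<^sup>2) \<longlonglongrightarrow> 0" by simp
  have "eventually (\<lambda>t. norm ((x t)\<^sup>2) \<le> C t * (inverse (w t))\<^sup>2) sequentially"
    using le filterlim_at_top_dense[THEN iffD1, OF w, rule_format, of 0]
    by eventually_elim (simp add: field_simps)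
  then have "(\<lambda>t. (x t)\<^sup>2) \<longlonglongrightarrow> 0"
    by (rule Lim_null_comparison[OF _ lim])
  then show ?thesis by simp
qed

theorem theorem2p3:
  fixes m n k :: nat and A1 A2 :: "real mat" and \<tau> :: real
    and Xhat :: "real mat \<times> real mat \<Rightarrow> real mat \<times> real mat"
  assumes "k \<le> n"
    and "A1 \<in> carrier_mat m k" and "A2 \<in> carrier_mat m (n - k)"
    and "\<tau> > 0"
    and "\<And>W1 W2. \<lbrakk> W1 \<in> carrier_mat m k; W2 \<in> carrier_mat m (n - k);
             \<forall>i<m. \<forall>j<k. W1 $$ (i, j) > 0; \<forall>i<m. \<forall>j<n - k. W2 $$ (i, j) > 0 \<rbrakk>
           \<Longrightarrow> weighted_solution m n k \<tau> (A1, A2) (W1, W2) (Xhat (W1, W2))"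
  shows "\<forall>X. accumulation_point m n k Xhat X \<longrightarrow>
           X \<in> (\<Union>r\<in>{0..min m n}. A_G m n k (A1, A2) r)"
proof (intro allI impI)
  fix X assume acc: "accumulation_point m n k Xhat X"

  \<comment> \<open>Minimizers along a sequence of weights\<close>
  define l where "l = n - k"
  have kl: "k + l = n" using assms(1) by (simp add: l_def)
  note A1 = assms(2) and A2 = assms(3)[folded l_def]
  obtain X1 X2 where X: "X = (X1, X2)" by (cases X)
  from acc obtain W where W: "weights_limit m n k W"
    and lim: "(\<lambda>t. frobenius_norm (case_prod hcat (Xhat (W t)) - hcat X1 X2)) \<longlonglongrightarrow> 0"
    and X1: "X1 \<in> carrier_mat m k" and X2: "X2 \<in> carrier_mat m l"
    unfolding accumulation_point_def X block_pairs_def l_def by auto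
  define W1 W2 Y1 Y2 where "W1 t = fst (W t)" and "W2 t = snd (W t)"
    and "Y1 t = fst (Xhat (W t))" and "Y2 t = snd (Xhat (W t))" for t
  have Wc: "W1 t \<in> carrier_mat m k" "W2 t \<in> carrier_mat m l" for t
    using W unfolding weights_limit_def block_pairs_def W1_def W2_def l_def
    by (auto simp: mem_Times_iff)
  have W1lim: "filterlim (\<lambda>t. W1 t $$ (i, j)) at_top sequentially" if "i < m" "j < k" for i j
    using W that unfolding weights_limit_def W1_def by auto
  have W2lim: "(\<lambda>t. W2 t $$ (i, j)) \<longlonglongrightarrow> 1" if "i < m" "j < l" for i j
    using W that unfolding weights_limit_def W2_def l_def by auto
  let ?E1 = "\<lambda>t Z. \<Sum>i<m. \<Sum>j<k. ((A1 $$ (i, j) - Z $$ (i, j)) * W1 t $$ (i, j))\<^sup>2"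
  let ?E2 = "\<lambda>t Z. \<Sum>i<m. \<Sum>j<l. ((A2 $$ (i, j) - Z $$ (i, j)) * W2 t $$ (i, j))\<^sup>2"
  let ?L2 = "\<lambda>Z. \<Sum>i<m. \<Sum>j<l. (A2 $$ (i, j) - Z $$ (i, j))\<^sup>2"
  \<comment> \<open>Minimizers are given only for positive weights. Finitely many entries tend to
    \<infinity> or to 1, so all are positive from some index on.\<close>
  have sol: "eventually (\<lambda>t. weighted_solution m n k \<tau> (A1, A2) (W t) (Xhat (W t))) sequentially"
  proof -
    have "eventually (\<lambda>t. \<forall>i\<in>{..<m}. \<forall>j\<in>{..<k}. W1 t $$ (i, j) > 0) sequentially"
      using W1lim by (auto intro!: eventually_ball_finite simp: filterlim_at_top_dense)
    moreover have "eventually (\<lambda>t. \<forall>i\<in>{..<m}. \<forall>j\<in>{..<l}. W2 t $$ (i, j) > 0) sequentially"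
      using W2lim by (auto intro!: eventually_ball_finite order_tendstoD(1))
    ultimately show ?thesis
    proof eventually_elim
      case (elim t)
      then have "weighted_solution m n k \<tau> (A1, A2) (W1 t, W2 t) (Xhat (W1 t, W2 t))"
        using Wc[of t] by (intro assms(5)) (auto simp: l_def)
      then show ?case by (simp add: W1_def W2_def)
    qed
  qed
  have Yc: "eventually (\<lambda>t. Y1 t \<in> carrier_mat m k \<and> Y2 t \<in> carrier_mat m l) sequentially"
    using sol by eventually_elim
      (auto simp: weighted_solution_def is_arg_min_def block_pairs_def Y1_def Y2_def l_def mem_Times_iff)
  \<comment> \<open>The competitor \<open>(A1, Z)\<close> has no first-block error, so the diverging
    weights disappear from the right-hand side.\<close>
  have opt: "eventually (\<lambda>t. ?E1 t (Y1 t) + ?E2 t (Y2 t) + \<tau> * mat_rank (hcat (Y1 t) (Y2 t))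
      \<le> ?E2 t Z + \<tau> * mat_rank (hcat A1 Z)) sequentially" if Z: "Z \<in> carrier_mat m l" for Z
    using sol Yc
  proof eventually_elim
    case (elim t)
    have Wt: "W t = (W1 t, W2 t)" and Yt: "Xhat (W t) = (Y1 t, Y2 t)"
      by (simp_all add: W1_def W2_def Y1_def Y2_def)
    have "(A1, Z) \<in> block_pairs m n k" using A1 Z by (simp add: block_pairs_def l_def)
    then have "weighted_objective \<tau> (A1, A2) (W t) (Xhat (W t))
        \<le> weighted_objective \<tau> (A1, A2) (W t) (A1, Z)"
      using elim(1) unfolding weighted_solution_def is_arg_min_def by (meson not_le)
    then show ?case
      using elim(2) A1 A2 Z Wc[of t] unfolding weighted_objective_def Yt unfolding Wt
      by (simp add: weighted_error_split)
  qed
  have E2lim: "(\<lambda>t. ?E2 t Z) \<longlonglongrightarrow> ?L2 Z" for Z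
  proof -
    have "(\<lambda>t. ?E2 t Z) \<longlonglongrightarrow> (\<Sum>i<m. \<Sum>j<l. ((A2 $$ (i, j) - Z $$ (i, j)) * 1)\<^sup>2)"
      by (intro tendsto_intros W2lim) auto
    then show ?thesis by simp
  qed
  have Xc: "hcat X1 X2 \<in> carrier_mat m n" using hcat_carrier[OF X1 X2] kl by simp
  have Hc: "eventually (\<lambda>t. hcat (Y1 t) (Y2 t) \<in> carrier_mat m n) sequentially"
    using Yc by eventually_elim (use hcat_carrier kl in auto)
  have Hlim: "(\<lambda>t. hcat (Y1 t) (Y2 t) $$ (i, j)) \<longlonglongrightarrow> hcat X1 X2 $$ (i, j)" if "i < m" "j < n" for i j
    using lim that by (intro frobenius_norm_tendsto_0_imp_entries[OF Xc Hc])
      (simp_all add: Y1_def Y2_def case_prod_unfold)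
  \<comment> \<open>The blocks have the right dimensions only eventually, so the limits are
    transferred from \<open>hcat\<close> along eventual equalities.\<close>
  have Y1lim: "(\<lambda>t. Y1 t $$ (i, j)) \<longlonglongrightarrow> X1 $$ (i, j)" if ij: "i < m" "j < k" for i j
  proof -
    have "eventually (\<lambda>t. hcat (Y1 t) (Y2 t) $$ (i, j) = Y1 t $$ (i, j)) sequentially"
      using Yc by eventually_elim (use hcat_index ij in auto)
    with Hlim[of i j] ij kl hcat_index[OF X1 X2, of i j] show ?thesis
      by (simp add: tendsto_cong)
  qed
  have Y2lim: "(\<lambda>t. Y2 t $$ (i, j)) \<longlonglongrightarrow> X2 $$ (i, j)" if ij: "i < m" "j < l" for i j
  proof -
    have "eventually (\<lambda>t. hcat (Y1 t) (Y2 t) $$ (i, k + j) = Y2 t $$ (i, j)) sequentially"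
      using Yc by eventually_elim (use hcat_index ij in auto)
    with Hlim[of i "k + j"] ij kl hcat_index[OF X1 X2, of i "k + j"] show ?thesis
      by (simp add: tendsto_cong)
  qed

  \<comment> \<open>The first block of the limit\<close>
  have "X1 = A1"
  proof (rule eq_matI)
    fix i j assume "i < dim_row A1" "j < dim_col A1"
    then have ij: "i < m" "j < k" using A1 by auto
    \<comment> \<open>The objective at this fixed competitor converges, hence stays bounded while
      the weights in \<open>W1\<close> diverge.\<close>
    let ?Z = "0\<^sub>m m l :: real mat"
    have "eventually (\<lambda>t. ((A1 $$ (i, j) - Y1 t $$ (i, j)) * W1 t $$ (i, j))\<^sup>2
        \<le> ?E2 t ?Z + \<tau> * mat_rank (hcat A1 ?Z)) sequentially"
      using opt[of ?Z, OF zero_carrier_mat]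
    proof eventually_elim
      case (elim t)
      have "((A1 $$ (i, j) - Y1 t $$ (i, j)) * W1 t $$ (i, j))\<^sup>2 \<le> ?E1 t (Y1 t)"
        by (rule entry_sq_le_sum[OF ij])
      moreover have "0 \<le> ?E2 t (Y2 t)" by (intro sum_nonneg) auto
      moreover have "0 \<le> \<tau> * mat_rank (hcat (Y1 t) (Y2 t))" using assms(4) by simp
      ultimately show ?case using elim by linarith
    qed
    then have "(\<lambda>t. A1 $$ (i, j) - Y1 t $$ (i, j)) \<longlonglongrightarrow> 0"
      by (rule tendsto_zero_of_mult_bounded[OF W1lim[OF ij] tendsto_add[OF E2lim tendsto_const]])
    moreover have "(\<lambda>t. A1 $$ (i, j) - Y1 t $$ (i, j)) \<longlonglongrightarrow> A1 $$ (i, j) - X1 $$ (i, j)"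
      by (intro tendsto_intros Y1lim ij)
    ultimately have "A1 $$ (i, j) - X1 $$ (i, j) = 0" using LIMSEQ_unique by blast
    then show "X1 $$ (i, j) = A1 $$ (i, j)" by simp
  qed (use A1 X1 in auto)

  \<comment> \<open>Optimality of the second block among matrices of rank at most that of the
    limit\<close>
  define r where "r = mat_rank (hcat X1 X2)"
  have rank_ev: "eventually (\<lambda>t. r \<le> mat_rank (hcat (Y1 t) (Y2 t))) sequentially"
    unfolding r_def by (rule eventually_mat_rank_ge[OF Xc Hc Hlim])
  have min: "?L2 X2 \<le> ?L2 Z"
    if Z: "Z \<in> carrier_mat m l" and rZ: "mat_rank (hcat A1 Z) \<le> r" for Z
  proof (rule tendsto_le[OF _ E2lim])
    have "(\<lambda>t. ?E2 t (Y2 t)) \<longlonglongrightarrow> (\<Sum>i<m. \<Sum>j<l. ((A2 $$ (i, j) - X2 $$ (i, j)) * 1)\<^sup>2)"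
      by (intro tendsto_intros W2lim Y2lim) auto
    then show "(\<lambda>t. ?E2 t (Y2 t)) \<longlonglongrightarrow> ?L2 X2" by simp
    \<comment> \<open>The penalties are compared before the limit is taken, as the ranks themselves
      are not known to converge: eventually the minimizer pays at least as much as
      \<open>(A1, Z)\<close>.\<close>
    show "eventually (\<lambda>t. ?E2 t (Y2 t) \<le> ?E2 t Z) sequentially"
      using opt[OF Z] rank_ev
    proof eventually_elim
      case (elim t)
      have "0 \<le> ?E1 t (Y1 t)" by (intro sum_nonneg) auto
      moreover have "\<tau> * mat_rank (hcat A1 Z) \<le> \<tau> * mat_rank (hcat (Y1 t) (Y2 t))"
        using rZ elim(2) assms(4) by simp
      ultimately show ?case using elim(1) by linarith
    qed
  qed simp
  \<comment> \<open>\<open>X\<close> is feasible because its rank is \<open>r\<close>. Every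
    feasible pair has first block \<open>A1\<close>, so the constrained objective reduces to
    \<open>?L2\<close>.\<close>
  have "X \<in> A_G m n k (A1, A2) r"
    using X1 X2 A1 A2 min
    by (auto simp: A_G_def is_arg_min_def X \<open>X1 = A1\<close> r_def block_pairs_def error_split not_less
        simp flip: l_def)
  moreover have "r \<le> min m n" unfolding r_def by (rule mat_rank_le_min[OF Xc])
  ultimately show "X \<in> (\<Union>r\<in>{0..min m n}. A_G m n k (A1, A2) r)" by auto
qed

end
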